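(* For a nonempty subset $\varepsilon=\{i_1,\dots,i_k\}\subseteq[r]$ put $\mathbf{x}^{\varepsilon}:=\prod_{i\in\varepsilon}x_i=x_{i_1}\cdots x_{i_k}$. Then $$I(\mathbb{A}^r_G)=\sum_{\emptyset\neq\varepsilon\subseteq[r]}\mathbf{x}^{\varepsilon}\cdot I_{(q-1)L_{\beta(\varepsilon)}},$$ where $\mathbf{x}^{\varepsilon}\cdot I_{(q-1)L_{\beta(\varepsilon)}}$ denotes the ideal of $S$ generated by the products $\mathbf{x}^{\varepsilon}F$ with $F\in I_{(q-1)L_{\beta(\varepsilon)}}$.
   Context: Let $\beta=[\beta_1\cdots\beta_r]$ be a $d\times r$ matrix of rank $d$ with non-negative integer entries, $n=r-d>0$, $[r]=\{1,\dots,r\}$. Let $\mathbb{F}_q$ be a finite field and $S=\mathbb{F}_q[x_1,\dots,x_r]$, which is $\mathbb{Z}^d$-graded by $\deg_\beta(x_j)=\beta_j$ (the graded pieces $S_\alpha$ are finite-dimensional); "homogeneous" refers to this grading. It is assumed that there is a short exact sequence $0\to\mathbb{Z}^n\xrightarrow{\phi}\mathbb{Z}^r\xrightarrow{\beta}\mathbb{Z}^d\to 0$; let $\mathbf{u}_1,\dots,\mathbf{u}_n$ be the columns of $\phi$. In this result the base field is $\mathbb{K}=\mathbb{F}_q$: $\mathbb{A}^r=\mathbb{F}_q^r$, $G=\{\mathbf{t}\in(\mathbb{F}_q^* )^r:\mathbf{t}^{\mathbf{u}_1}=\cdots=\mathbf{t}^{\mathbf{u}_n}=1\}$ acts on $\mathbb{A}^r$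 by coordinatewise multiplication, and $\mathbb{A}^r_G=\mathbb{F}_q^r/G$ is the set of $G$-orbits $[P]=G\cdot P$. For a set $Y_G$ of orbits, $I(Y_G)\subseteq S$ is the ideal generated by the homogeneous polynomials vanishing at all points $P$ with $[P]\in Y_G$ (for homogeneous $F$, vanishing at $P$ depends only on $[P]$). For nonempty $\varepsilon\subseteq[r]$: $S[\varepsilon]=\mathbb{F}_q[x_i:i\in\varepsilon]$; $\beta(\varepsilon)$ is the matrix with columns $\beta_j$, $j\in\varepsilon$; $L_{\beta(\varepsilon)}=\mathrm{Ker}(\beta(\varepsilon))\subseteq\mathbb{Z}^{\varepsilon}$. For a lattice (subgroup) $L\subseteq\mathbb{Z}^{\varepsilon}$, the lattice ideal is $I_L=\langle\mathbf{x}^{\mathbf{m}^+}-\mathbf{x}^{\mathbf{m}^-}:\mathbf{m}=\mathbf{m}^+-\mathbf{m}^-\in L\rangle\subseteq S[\varepsilon]$, where $\mathbf{m}^+,\mathbf{m}^-$ record the positive and negative parts of $\mathbf{m}$; $(q-1)L=\{(q-1)\mathbf{m}:\mathbf{m}\in L\}$. *)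

theory Defs
  imports "HOL-Analysis.Analysis" "HOL-Library.Poly_Mapping" "HOL-Library.Set_Algebras"
begin

text \<open>
  The index sets are finite types: \<open>'r\<close> plays the role of $[r]$ and \<open>'d\<close>, \<open>'n\<close> index the
  coordinates of $\mathbb{Z}^d$ and $\mathbb{Z}^n$. A polynomial maps exponent vectors
  to coefficients, with finite support.
\<close>

type_synonym ('r, 'a) mpoly = "('r \<Rightarrow>\<^sub>0 nat) \<Rightarrow>\<^sub>0 'a"

definition Const :: "'a::zero \<Rightarrow> ('r, 'a) mpoly"
  where "Const c = Poly_Mapping.single 0 c"

definition Var :: "'r \<Rightarrow> ('r, 'a::zero_neq_one) mpoly"
  where "Var j = Poly_Mapping.single (Poly_Mapping.single j 1) 1"

definition eval :: "'a::comm_ring_1 ^ 'r \<Rightarrow> ('r, 'a) mpoly \<Rightarrow> 'a"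
  where "eval P F = (\<Sum>m\<in>Poly_Mapping.keys F.
           Poly_Mapping.lookup F m * (\<Prod>j\<in>UNIV. (P $ j) ^ Poly_Mapping.lookup m j))"


section \<open>Ideals\<close>

text \<open>\<open>module.span (*) B\<close> is the ideal generated by \<open>B\<close> in the whole ring; lattice ideals live
  in a subring, so the ring has to be an argument. By \<open>Set_Algebras\<close>, \<open>+\<close> and \<open>\<Sum>\<close> on sets
  are elementwise, which for ideals is the sum of ideals.\<close>

abbreviation ideal :: "'a::comm_ring_1 set \<Rightarrow> 'a set"
  where "ideal \<equiv> module.span (*)"

definition ideal_in :: "'a::comm_ring_1 set \<Rightarrow> 'a set \<Rightarrow> 'a set"
  where "ideal_in R B = {(\<Sum>b\<in>T. c b * b) | T c. finite T \<and> T \<subseteq> B \<and> c ` T \<subseteq> R}"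

lemma module_times: "module ((*) :: 'a::comm_ring_1 \<Rightarrow> 'a \<Rightarrow> 'a)"
  by standard (simp_all add: algebra_simps)

lemma ideal_in_UNIV: "ideal_in UNIV B = ideal B"
  by (auto simp: ideal_in_def module.span_explicit[OF module_times])


section \<open>The grading\<close>

definition mono_degree :: "int ^ 'r ^ 'd \<Rightarrow> ('r \<Rightarrow>\<^sub>0 nat) \<Rightarrow> int ^ 'd"
  where "mono_degree \<beta> m = (\<Sum>j\<in>UNIV. int (Poly_Mapping.lookup m j) *s column j \<beta>)"

definition graded_piece :: "int ^ 'r ^ 'd \<Rightarrow> int ^ 'd \<Rightarrow> ('r, 'a::zero) mpoly set"
  where "graded_piece \<beta> \<alpha> = {F. \<forall>m\<in>Poly_Mapping.keys F. mono_degree \<beta> m = \<alpha>}"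

definition homogeneous :: "int ^ 'r ^ 'd \<Rightarrow> ('r, 'a::zero) mpoly \<Rightarrow> bool"
  where "homogeneous \<beta> F \<longleftrightarrow> (\<exists>\<alpha>. F \<in> graded_piece \<beta> \<alpha>)"

definition finite_dimensional :: "('r, 'a::field) mpoly set \<Rightarrow> bool"
  where "finite_dimensional V \<longleftrightarrow> (\<exists>B. finite B \<and> module.span (\<lambda>c F. Const c * F) B = V)"

lemma module_Const: "module (\<lambda>c F. Const c * F :: ('r, 'a::field) mpoly)"
  by standard
     (simp_all add: Const_def algebra_simps single_add mult_single flip: mult.assoc)


section \<open>The group action and vanishing ideals\<close>

text \<open>The entries of \<open>\<phi>\<close> may be negative, whence the integer power \<open>powi\<close>.\<close>

definition torus_subgroup :: "int ^ 'n ^ 'r \<Rightarrow> ('a::field ^ 'r) set"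
  where "torus_subgroup \<phi> =
           {t. (\<forall>j. t $ j \<noteq> 0) \<and> (\<forall>k. (\<Prod>j\<in>UNIV. (t $ j) powi (column k \<phi> $ j)) = 1)}"

definition orbit :: "int ^ 'n ^ 'r \<Rightarrow> 'a::field ^ 'r \<Rightarrow> ('a ^ 'r) set"
  where "orbit \<phi> P = (\<lambda>t. \<chi> j. t $ j * P $ j) ` torus_subgroup \<phi>"

definition affine_orbits :: "int ^ 'n ^ 'r \<Rightarrow> ('a::field ^ 'r) set set"
  where "affine_orbits \<phi> = range (orbit \<phi>)"

definition vanishing_ideal ::
    "int ^ 'r ^ 'd \<Rightarrow> int ^ 'n ^ 'r \<Rightarrow> ('a::field ^ 'r) set set \<Rightarrow> ('r, 'a) mpoly set"
  where "vanishing_ideal \<beta> \<phi> Y =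
           ideal {F. homogeneous \<beta> F \<and> (\<forall>P. orbit \<phi> P \<in> Y \<longrightarrow> eval P F = 0)}"


section \<open>Lattice ideals\<close>

definition poly_subring :: "'r set \<Rightarrow> ('r, 'a::zero) mpoly set"
  where "poly_subring \<epsilon> = {F. \<forall>m\<in>Poly_Mapping.keys F. Poly_Mapping.keys m \<subseteq> \<epsilon>}"

text \<open>$\mathbb{Z}^\varepsilon$ is embedded in $\mathbb{Z}^r$ as the vectors vanishing
  outside \<open>\<epsilon>\<close>.\<close>

definition kernel_lattice :: "int ^ 'r ^ 'd \<Rightarrow> 'r set \<Rightarrow> (int ^ 'r) set"
  where "kernel_lattice \<beta> \<epsilon> =
           {m. (\<forall>j. j \<notin> \<epsilon> \<longrightarrow> m $ j = 0) \<and> (\<Sum>j\<in>\<epsilon>. m $ j *s column j \<beta>) = 0}"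

definition scale_lattice :: "nat \<Rightarrow> (int ^ 'r) set \<Rightarrow> (int ^ 'r) set"
  where "scale_lattice k L = (\<lambda>m. int k *s m) ` L"

text \<open>Since \<open>nat\<close> truncates negative integers to 0, the two products are
  $\mathbf{x}^{\mathbf{m}^+}$ and $\mathbf{x}^{\mathbf{m}^-}$.\<close>

definition lattice_binomial :: "int ^ 'r \<Rightarrow> ('r, 'a::comm_ring_1) mpoly"
  where "lattice_binomial m =
           (\<Prod>j\<in>UNIV. Var j ^ nat (m $ j)) - (\<Prod>j\<in>UNIV. Var j ^ nat (- (m $ j)))"

definition lattice_ideal :: "'r set \<Rightarrow> (int ^ 'r) set \<Rightarrow> ('r, 'a::comm_ring_1) mpoly set"
  where "lattice_ideal \<epsilon> L = ideal_in (poly_subring \<epsilon>) (lattice_binomial ` L)"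

definition squarefree_monomial :: "'r set \<Rightarrow> ('r, 'a::comm_ring_1) mpoly"
  where "squarefree_monomial \<epsilon> = (\<Prod>i\<in>\<epsilon>. Var i)"

end

theory Submission
  imports Defs "HOL-Computational_Algebra.Polynomial"
begin

text \<open>
  As a function on $\mathbb{F}_q^r$ a monomial depends only on its support and on its exponents
  modulo \<open>q - 1\<close>. Distinct monomials with exponents at most \<open>q - 1\<close> are linearly
  independent functions, so the coefficients of a vanishing \<open>F\<close> sum to zero over each class of
  monomials defining the same function. Hence \<open>F\<close> is a combination of differences
  $x^m - x^{m'}$ within a class. If \<open>F\<close> is homogeneous, then $m - m' = (q-1)v$ with
  $\beta v = 0$, and for the common support $\varepsilon$ the difference is a monomial times
  $x^\varepsilon$ times the binomial of $(q-1)v$.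
\<close>

section \<open>Monomials, evaluation and degree\<close>

text \<open>Over a finite index type this is the inverse of \<open>Poly_Mapping.lookup\<close>, so
  exponent vectors can be given as plain functions and added pointwise.\<close>

definition expo :: "('r::finite \<Rightarrow> nat) \<Rightarrow> 'r \<Rightarrow>\<^sub>0 nat"
  where "expo f = (\<Sum>j\<in>UNIV. Poly_Mapping.single j (f j))"

lemma lookup_expo [simp]: "Poly_Mapping.lookup (expo f) j = f j"
  by (simp add: expo_def lookup_sum lookup_single when_def)

lemma expo_add: "expo f + expo g = expo (\<lambda>j. f j + g j)"
  by (rule poly_mapping_eqI) (simp add: lookup_add)

lemma expo_lookup [simp]: "expo (Poly_Mapping.lookup m) = m"
  by (rule poly_mapping_eqI) simp

lemma Var_power:
  "(Var j :: ('r, 'a::comm_ring_1) mpoly) ^ k = Poly_Mapping.single (Poly_Mapping.single j k) 1"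
  by (induction k) (simp_all add: Var_def mult_single flip: single_add)

lemma prod_Var_power:
  "(\<Prod>j\<in>UNIV. (Var j :: ('r::finite, 'a::comm_ring_1) mpoly) ^ f j) =
     Poly_Mapping.single (expo f) 1"
proof -
  have "(\<Prod>j\<in>A. (Var j :: ('r, 'a) mpoly) ^ f j) =
     Poly_Mapping.single (\<Sum>j\<in>A. Poly_Mapping.single j (f j)) 1" for A
    by (induction A rule: infinite_finite_induct) (simp_all add: Var_power mult_single)
  then show ?thesis
    by (simp add: expo_def)
qed

lemma lattice_binomial_eq:
  "(lattice_binomial m :: ('r::finite, 'a::comm_ring_1) mpoly) =
     Poly_Mapping.single (expo (\<lambda>j. nat (m $ j))) 1 -
     Poly_Mapping.single (expo (\<lambda>j. nat (- (m $ j)))) 1"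
  by (simp add: lattice_binomial_def prod_Var_power)

lemma squarefree_monomial_eq:
  "(squarefree_monomial \<epsilon> :: ('r::finite, 'a::comm_ring_1) mpoly) =
     Poly_Mapping.single (expo (\<lambda>j. of_bool (j \<in> \<epsilon>))) 1"
proof -
  have "(\<Prod>i\<in>\<epsilon>. Var i :: ('r, 'a) mpoly) = (\<Prod>i\<in>UNIV. Var i ^ of_bool (i \<in> \<epsilon>))"
    by (rule prod.mono_neutral_cong_left) auto
  then show ?thesis
    by (simp add: squarefree_monomial_def prod_Var_power)
qed

lemma eval_superset:
  assumes "finite A" "Poly_Mapping.keys F \<subseteq> A"
  shows "eval P F = (\<Sum>m\<in>A. Poly_Mapping.lookup F m * (\<Prod>j\<in>UNIV. (P $ j) ^ Poly_Mapping.lookup m j))"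
  unfolding eval_def using assms
  by (intro sum.mono_neutral_left) (auto simp: in_keys_iff)

lemma eval_single_diff:
  fixes P :: "'a::comm_ring_1 ^ 'r"
  shows "eval P (Poly_Mapping.single u 1 - Poly_Mapping.single v 1) =
     (\<Prod>j\<in>UNIV. (P $ j) ^ Poly_Mapping.lookup u j) - (\<Prod>j\<in>UNIV. (P $ j) ^ Poly_Mapping.lookup v j)"
proof (cases "u = v")
  case True
  then show ?thesis by (simp add: eval_def)
next
  case False
  have "Poly_Mapping.keys (Poly_Mapping.single u 1 - Poly_Mapping.single v (1::'a)) \<subseteq> {u, v}"
    by (auto simp: in_keys_iff lookup_minus lookup_single when_def split: if_splits)
  from eval_superset[OF _ this] False show ?thesis
    by (simp add: lookup_minus lookup_single when_def)
qed

lemma mpoly_sum_monomials: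
  "F = (\<Sum>m\<in>Poly_Mapping.keys F. Poly_Mapping.single m (Poly_Mapping.lookup F m))"
  by (rule poly_mapping_eqI)
     (simp add: lookup_sum lookup_single when_def in_keys_iff)

lemma mono_degree_nth:
  "mono_degree \<beta> m $ i = (\<Sum>j\<in>UNIV. int (Poly_Mapping.lookup m j) * \<beta> $ i $ j)"
  by (simp add: mono_degree_def column_def)

lemma homogeneous_single_diff:
  assumes "mono_degree \<beta> u = mono_degree \<beta> v"
  shows "homogeneous \<beta> (Poly_Mapping.single u 1 - Poly_Mapping.single v 1 :: ('r::finite, 'a::comm_ring_1) mpoly)"
  unfolding homogeneous_def graded_piece_def using assms
  by (intro exI[of _ "mono_degree \<beta> u"])
     (auto simp: in_keys_iff lookup_minus lookup_single when_def split: if_splits)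

section \<open>Powers in a finite field and reduction of exponents\<close>

text \<open>Multiplication by \<open>x\<close> permutes the nonzero elements, so their product is
  unchanged when each is multiplied by \<open>x\<close>; this product is nonzero and
  cancels.\<close>

lemma field_power_card_minus_1:
  assumes "x \<noteq> (0 :: 'a::{field,finite})"
  shows "x ^ (CARD('a) - 1) = 1"
proof -
  have "x ^ (CARD('a) - 1) * \<Prod>(UNIV - {0}) = (\<Prod>y\<in>UNIV - {0}. x * y)"
    by (simp add: prod.distrib)
  also have "\<dots> = \<Prod>(UNIV - {0})"
    by (rule prod.reindex_bij_witness[of _ "\<lambda>y. y / x" "\<lambda>y. x * y"]) (use assms in auto)
  finally show ?thesis
    by simp
qed

lemma card_field_ge_2: "CARD('a::{field,finite}) \<ge> 2"
  using card_mono[of UNIV "{0, 1 :: 'a}"] by simp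

text \<open>Exponents are reduced into \<open>{0..q - 1}\<close> rather than modulo \<open>q - 1\<close>,
  so that the support of the exponent vector survives.\<close>

definition reduce_exp :: "nat \<Rightarrow> nat \<Rightarrow> nat"
  where "reduce_exp q n = (if n = 0 then 0 else Suc ((n - 1) mod (q - 1)))"

lemma reduce_exp_less: "q \<ge> 2 \<Longrightarrow> reduce_exp q n < q"
  unfolding reduce_exp_def using mod_less_divisor[of "q - 1" "n - 1"]
  by (auto simp del: mod_less_divisor)

text \<open>For nonzero \<open>x\<close> the two exponents differ by a multiple of the order
  \<open>CARD('a) - 1\<close> of the unit group. For \<open>x = 0\<close> it suffices that reduction
  sends exactly the exponent 0 to 0.\<close>

lemma power_reduce_exp:
  fixes x :: "'a::{field,finite}"
  shows "x ^ reduce_exp CARD('a) n = x ^ n"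
proof (cases "x = 0 \<or> n = 0")
  case True
  then show ?thesis by (auto simp: reduce_exp_def power_0_left)
next
  case False
  define q where "q = CARD('a) - 1"
  have "n = Suc ((n - 1) mod q) + q * ((n - 1) div q)"
    using False by (simp add: mod_mult_div_eq[of "n - 1" q])
  then have "x ^ n = x ^ Suc ((n - 1) mod q) * (x ^ q) ^ ((n - 1) div q)"
    by (metis power_add power_mult)
  moreover have "x ^ q = 1"
    unfolding q_def using False by (intro field_power_card_minus_1) simp
  ultimately show ?thesis
    using False unfolding reduce_exp_def q_def[symmetric] by simp
qed

text \<open>The first part makes monomials of one class share their support, the second makes the
  exponent difference divisible. The difference is taken in the integers because it may be
  negative.\<close>

lemma reduce_exp_eqD:
  assumes "reduce_exp q a = reduce_exp q b"
  shows "a = 0 \<longleftrightarrow> b = 0" "int (q - 1) dvd int a - int b"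
proof -
  show *: "a = 0 \<longleftrightarrow> b = 0"
    using assms by (auto simp: reduce_exp_def split: if_splits)
  show "int (q - 1) dvd int a - int b"
  proof (cases "a = 0")
    case False
    with * assms have "(a - 1) mod (q - 1) = (b - 1) mod (q - 1)"
      by (simp add: reduce_exp_def)
    then have "int (a - 1) mod int (q - 1) = int (b - 1) mod int (q - 1)"
      by (metis zmod_int)
    then have "int (q - 1) dvd int (a - 1) - int (b - 1)"
      by (simp add: mod_eq_dvd_iff)
    moreover have "int (a - 1) - int (b - 1) = int a - int b"
      using False * by simp
    ultimately show ?thesis by simp
  qed (use * in simp)
qed

section \<open>Linear independence of the reduced monomials as functions\<close>

text \<open>A polynomial of degree below \<open>CARD('a)\<close> with every field element as a root
  has more roots than its degree allows, unless it is zero.\<close>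

lemma reduced_univariate_zero:
  fixes c :: "nat \<Rightarrow> 'a::{field,finite}"
  assumes "\<And>x. (\<Sum>k<CARD('a). c k * x ^ k) = 0" "k < CARD('a)"
  shows "c k = 0"
proof -
  define p where "p = (\<Sum>i<CARD('a). monom (c i) i)"
  have coeff: "coeff p i = (if i < CARD('a) then c i else 0)" for i
    by (simp add: p_def coeff_sum coeff_monom sum.delta)
  have "degree p \<le> CARD('a) - 1"
    by (rule degree_le) (auto simp: coeff)
  then have "degree p < CARD('a)"
    using card_field_ge_2[where 'a='a] by linarith
  moreover have "poly p x = 0" for x
    using assms(1) by (simp add: p_def poly_sum poly_monom)
  ultimately have "p = 0"
    using card_poly_roots_bound[of p] by auto
  then show ?thesis
    using coeff[of k] assms(2) by simp
qed

text \<open>Induction on the set of variables: with the other coordinates fixed, the function is a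
  univariate polynomial in the new variable, so each of its coefficients vanishes. These
  coefficients are reduced functions of the remaining variables. Extensional exponent functions make
  the decomposition \<open>f = g(x := k)\<close> unique.\<close>

lemma reduced_function_zero:
  fixes c :: "('r \<Rightarrow> nat) \<Rightarrow> 'a::{field,finite}"
  assumes "finite A"
    and "\<And>P. (\<Sum>f\<in>Pi\<^sub>E A (\<lambda>_. {..<CARD('a)}). c f * (\<Prod>j\<in>A. P j ^ f j)) = 0"
    and "f \<in> Pi\<^sub>E A (\<lambda>_. {..<CARD('a)})"
  shows "c f = 0"
  using assms
proof (induction A arbitrary: c f rule: finite_induct)
  case empty
  then show ?case by simp
next
  case (insert x A)
  let ?T = "\<lambda>_ :: 'r. {..<CARD('a)}"
  have inner: "(\<Sum>g\<in>Pi\<^sub>E A ?T. c (g(x := k)) * (\<Prod>j\<in>A. P j ^ g j)) = 0"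
    if "k < CARD('a)" for k and P :: "'r \<Rightarrow> 'a"
  proof (rule reduced_univariate_zero[OF _ that])
    \<comment> \<open>The coordinate \<open>x\<close> takes the value \<open>y\<close> while the
      others stay as in \<open>P\<close>; collecting powers of \<open>y\<close> exhibits the
      univariate polynomial.\<close>
    fix y
    have "0 = (\<Sum>f\<in>Pi\<^sub>E (insert x A) ?T. c f * (\<Prod>j\<in>insert x A. (P(x := y)) j ^ f j))"
      using insert.prems(1)[of "P(x := y)"] by simp
    also have "\<dots> = (\<Sum>(k, g)\<in>?T x \<times> Pi\<^sub>E A ?T. c (g(x := k)) *
        (\<Prod>j\<in>insert x A. (P(x := y)) j ^ (g(x := k)) j))"
      unfolding PiE_insert_eq using inj_combinator[OF insert.hyps(2), of ?T]
      by (subst sum.reindex) (auto simp: case_prod_unfold o_def)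
    also have "\<dots> = (\<Sum>(k, g)\<in>?T x \<times> Pi\<^sub>E A ?T. c (g(x := k)) * (\<Prod>j\<in>A. P j ^ g j) * y ^ k)"
    proof (intro sum.cong refl, clarify)
      fix k g
      have "(\<Prod>j\<in>A. (P(x := y)) j ^ (g(x := k)) j) = (\<Prod>j\<in>A. P j ^ g j)"
        using insert.hyps(2) by (intro prod.cong) auto
      then show "c (g(x := k)) * (\<Prod>j\<in>insert x A. (P(x := y)) j ^ (g(x := k)) j) =
          c (g(x := k)) * (\<Prod>j\<in>A. P j ^ g j) * y ^ k"
        using insert.hyps by (simp add: ac_simps)
    qed
    also have "\<dots> = (\<Sum>k<CARD('a). (\<Sum>g\<in>Pi\<^sub>E A ?T. c (g(x := k)) * (\<Prod>j\<in>A. P j ^ g j)) * y ^ k)"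
      by (simp add: sum_distrib_right flip: sum.cartesian_product)
    finally show "(\<Sum>k<CARD('a). (\<Sum>g\<in>Pi\<^sub>E A ?T. c (g(x := k)) * (\<Prod>j\<in>A. P j ^ g j)) * y ^ k) = 0"
      by simp
  qed
  from insert.prems(2) obtain k g where "k < CARD('a)" "g \<in> Pi\<^sub>E A ?T" "f = g(x := k)"
    by (auto simp: PiE_insert_eq)
  with insert.IH[of "\<lambda>g. c (g(x := k))" g] inner show ?case
    by blast
qed

section \<open>Ideals and finite sums of ideals\<close>

lemmas ideal_zero = module.span_zero[OF module_times]
lemmas ideal_add = module.span_add[OF module_times]
lemmas ideal_scale = module.span_scale[OF module_times]
lemmas ideal_base = module.span_base[OF module_times]
lemmas ideal_sum = module.span_sum[OF module_times]
lemmas ideal_minimal = module.span_minimal[OF module_times]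
lemmas subspace_ideal = module.subspace_span[OF module_times]
lemmas subspace_zero = module.subspace_0[OF module_times]
lemmas subspace_sum_closed = module.subspace_sum[OF module_times]
lemmas subspace_mult = module.subspace_scale[OF module_times]
lemmas subspace_intro = module.subspaceI[OF module_times]

text \<open>Decompositions into summands can be added and scaled index by index. This lets the
  right-hand side of the theorem absorb linear combinations and contain a generated ideal once it
  contains the generators.\<close>

lemma subspace_sum_ideals:
  fixes B :: "'i \<Rightarrow> 'a::comm_ring_1 set"
  assumes "finite I"
  shows "module.subspace (*) (\<Sum>i\<in>I. ideal (B i))"
proof (rule subspace_intro)
  show "0 \<in> (\<Sum>i\<in>I. ideal (B i))"
    unfolding set_sum_alt[OF assms]
    by (auto intro!: exI[of _ "\<lambda>_. 0"] simp: ideal_zero)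
next
  fix x y assume "x \<in> (\<Sum>i\<in>I. ideal (B i))" "y \<in> (\<Sum>i\<in>I. ideal (B i))"
  then obtain s t where "x = sum s I" "y = sum t I" "\<forall>i\<in>I. s i \<in> ideal (B i)" "\<forall>i\<in>I. t i \<in> ideal (B i)"
    unfolding set_sum_alt[OF assms] by auto
  then show "x + y \<in> (\<Sum>i\<in>I. ideal (B i))"
    unfolding set_sum_alt[OF assms]
    by (auto intro!: exI[of _ "\<lambda>i. s i + t i"] simp: sum.distrib ideal_add)
next
  fix c x assume "x \<in> (\<Sum>i\<in>I. ideal (B i))"
  then obtain s where "x = sum s I" "\<forall>i\<in>I. s i \<in> ideal (B i)"
    unfolding set_sum_alt[OF assms] by auto
  then show "c * x \<in> (\<Sum>i\<in>I. ideal (B i))"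
    unfolding set_sum_alt[OF assms]
    by (auto intro!: exI[of _ "\<lambda>i. c * s i"] simp: sum_distrib_left ideal_scale)
qed

lemma ideal_subset_sum_ideals:
  fixes B :: "'i \<Rightarrow> 'a::comm_ring_1 set"
  assumes "finite I" "k \<in> I" "x \<in> ideal (B k)"
  shows "x \<in> (\<Sum>i\<in>I. ideal (B i))"
  unfolding set_sum_alt[OF assms(1)] using assms
  by (auto intro!: exI[of _ "\<lambda>i. if i = k then x else 0"] simp: ideal_zero)

section \<open>Lattice binomials multiplied by squarefree monomials\<close>

lemma kernel_lattice_iff:
  "m \<in> kernel_lattice \<beta> \<epsilon> \<longleftrightarrow>
     (\<forall>j. j \<notin> \<epsilon> \<longrightarrow> m $ j = 0) \<and> (\<forall>i. (\<Sum>j\<in>UNIV. m $ j * \<beta> $ i $ j) = 0)"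
proof -
  have "(\<Sum>j\<in>\<epsilon>. m $ j * \<beta> $ i $ j) = (\<Sum>j\<in>UNIV. m $ j * \<beta> $ i $ j)"
    if "\<forall>j. j \<notin> \<epsilon> \<longrightarrow> m $ j = 0" for i
    using that by (intro sum.mono_neutral_left) auto
  then show ?thesis
    by (auto simp: kernel_lattice_def vec_eq_iff column_def)
qed

lemma squarefree_monomial_times_binomial:
  "(Poly_Mapping.single (expo g) 1 :: ('r::finite, 'a::comm_ring_1) mpoly) *
     (squarefree_monomial \<epsilon> * lattice_binomial w) =
     Poly_Mapping.single (expo (\<lambda>j. g j + of_bool (j \<in> \<epsilon>) + nat (w $ j))) 1 -
     Poly_Mapping.single (expo (\<lambda>j. g j + of_bool (j \<in> \<epsilon>) + nat (- (w $ j)))) 1"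
  by (simp add: squarefree_monomial_eq lattice_binomial_eq right_diff_distrib mult_single
      expo_add add.assoc)

text \<open>The two monomials have exponents differing by a multiple of a kernel vector of \<beta>,
  hence equal degree. At a nonzero coordinate, powers divisible by the unit group order are 1. At a
  zero coordinate indexed by \<epsilon>, the squarefree factor kills both monomials, even if only
  one monomial of the binomial involves that variable.\<close>

lemma squarefree_monomial_times_lattice_binomial_vanishes:
  fixes \<beta> :: "int ^ 'r ^ 'd" and v :: "int ^ 'r"
  assumes v: "v \<in> kernel_lattice \<beta> \<epsilon>"
  defines "G \<equiv> squarefree_monomial \<epsilon> * lattice_binomial (int (CARD('a) - 1) *s v)
    :: ('r, 'a::{field,finite}) mpoly"
  shows "homogeneous \<beta> G" "eval P G = 0"
proof -
  define q where "q = CARD('a) - 1"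
  define s where "s = (\<lambda>j. of_bool (j \<in> \<epsilon>) :: nat)"
  define u where "u = expo (\<lambda>j. s j + nat (int q * v $ j))"
  define u' where "u' = expo (\<lambda>j. s j + nat (- (int q * v $ j)))"
  have "expo (\<lambda>_. 0) = (0 :: 'r \<Rightarrow>\<^sub>0 nat)"
    by (rule poly_mapping_eqI) simp
  then have one: "Poly_Mapping.single (expo (\<lambda>_ :: 'r. 0)) 1 = (1 :: ('r, 'a) mpoly)"
    by simp
  have G: "G = Poly_Mapping.single u 1 - Poly_Mapping.single u' 1"
    using squarefree_monomial_times_binomial[of "\<lambda>_. 0" \<epsilon> "int q *s v", where 'a='a]
    unfolding G_def q_def[symmetric] u_def u'_def s_def
    by (simp add: one)
  \<comment> \<open>Since \<open>nat a - nat (- a) = a\<close> over the integers, the exponents of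
    \<open>u\<close> and \<open>u'\<close> differ by \<open>int q * v $ j\<close>, and
    \<open>s j\<close> cancels.\<close>
  have "mono_degree \<beta> u $ i - mono_degree \<beta> u' $ i = int q * (\<Sum>j\<in>UNIV. v $ j * \<beta> $ i $ j)" for i
    unfolding mono_degree_nth sum_subtractf[symmetric] sum_distrib_left left_diff_distrib[symmetric]
    by (rule sum.cong) (auto simp: u_def u'_def)
  then have "mono_degree \<beta> u = mono_degree \<beta> u'"
    using v by (simp add: kernel_lattice_iff vec_eq_iff)
  then show "homogeneous \<beta> G"
    unfolding G by (rule homogeneous_single_diff)
  have pow: "x ^ nat (int q * k) = 1" if "x \<noteq> 0" for x :: 'a and k
    using field_power_card_minus_1[OF that, folded q_def]
    by (simp add: nat_mult_distrib power_mult)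
  \<comment> \<open>When \<open>P $ j = 0\<close>, both exponents are positive for \<open>j\<close>
    in \<epsilon>, and both are 0 outside \<epsilon>, where \<open>v\<close> vanishes.\<close>
  have "(P $ j) ^ Poly_Mapping.lookup u j = (P $ j) ^ Poly_Mapping.lookup u' j" for j
  proof (cases "P $ j = 0")
    case True
    then show ?thesis
      using v by (auto simp: u_def u'_def s_def power_0_left kernel_lattice_iff)
  next
    case False
    then show ?thesis
      using pow[of "P $ j" "v $ j"] pow[of "P $ j" "- v $ j"]
      by (simp add: u_def u'_def power_add)
  qed
  then show "eval P G = 0"
    by (simp add: G eval_single_diff)
qed

text \<open>Dividing the exponent difference by \<open>q\<close> gives the lattice vector. Equal
  supports make every variable of \<epsilon> divide both monomials, so their greatest common divisor
  contains the squarefree monomial as a factor.\<close>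

lemma monomial_diff_in_lattice_ideal:
  fixes \<beta> :: "int ^ 'r ^ 'd" and m m' :: "'r \<Rightarrow>\<^sub>0 nat"
  assumes q: "q > 0"
    and deg: "mono_degree \<beta> m = mono_degree \<beta> m'"
    and supp: "\<And>j. Poly_Mapping.lookup m j = 0 \<longleftrightarrow> Poly_Mapping.lookup m' j = 0"
    and cong: "\<And>j. int q dvd int (Poly_Mapping.lookup m j) - int (Poly_Mapping.lookup m' j)"
  shows "(Poly_Mapping.single m 1 - Poly_Mapping.single m' 1 :: ('r, 'a::comm_ring_1) mpoly) \<in>
     ideal ((\<lambda>F. squarefree_monomial (Poly_Mapping.keys m) * F) `
        lattice_ideal (Poly_Mapping.keys m)
          (scale_lattice q (kernel_lattice \<beta> (Poly_Mapping.keys m))))"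
proof -
  let ?\<epsilon> = "Poly_Mapping.keys m"
  define v :: "int ^ 'r"
    where "v = (\<chi> j. (int (Poly_Mapping.lookup m j) - int (Poly_Mapping.lookup m' j)) div int q)"
  have v: "int q * v $ j = int (Poly_Mapping.lookup m j) - int (Poly_Mapping.lookup m' j)" for j
    using cong by (simp add: v_def)
  have "int q * (\<Sum>j\<in>UNIV. v $ j * \<beta> $ i $ j) = mono_degree \<beta> m $ i - mono_degree \<beta> m' $ i" for i
    by (simp add: mono_degree_nth sum_distrib_left v left_diff_distrib sum_subtractf flip: mult.assoc)
  then have "(\<Sum>j\<in>UNIV. v $ j * \<beta> $ i $ j) = 0" for i
    using q deg by simp
  moreover have "v $ j = 0" if "j \<notin> ?\<epsilon>" for j
    using that supp[of j] by (simp add: v_def in_keys_iff)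
  ultimately have vL: "v \<in> kernel_lattice \<beta> ?\<epsilon>"
    by (simp add: kernel_lattice_iff)
  define b :: "('r, 'a) mpoly" where "b = lattice_binomial (int q *s v)"
  define L where "L = scale_lattice q (kernel_lattice \<beta> ?\<epsilon>)"
  \<comment> \<open>A single generator with coefficient 1, which lies in the subring because its
    only exponent vector is 0.\<close>
  have "b \<in> lattice_ideal ?\<epsilon> L"
    unfolding lattice_ideal_def ideal_in_def mem_Collect_eq
    using vL
    by (intro exI[of _ "{b}"] exI[of _ "\<lambda>_. 1"])
       (auto simp: b_def L_def scale_lattice_def poly_subring_def)
  then have "squarefree_monomial ?\<epsilon> * b \<in>
      ideal ((\<lambda>F. squarefree_monomial ?\<epsilon> * F) ` lattice_ideal ?\<epsilon> L)"
    by (intro ideal_base imageI)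
  moreover
  \<comment> \<open>The exponents of the greatest common divisor with the squarefree monomial
    divided out; \<open>pos\<close> ensures that the subtraction does not truncate. Adding the
    positive or negative part of the difference to the minimum recovers \<open>m\<close> or
    \<open>m'\<close>.\<close>
  define g where "g = (\<lambda>j. min (Poly_Mapping.lookup m j) (Poly_Mapping.lookup m' j) - of_bool (j \<in> ?\<epsilon>))"
  have pos: "min (Poly_Mapping.lookup m j) (Poly_Mapping.lookup m' j) \<ge> of_bool (j \<in> ?\<epsilon>)" for j
    using supp[of j] by (auto simp: in_keys_iff)
  have "g j + of_bool (j \<in> ?\<epsilon>) + nat ((int q *s v) $ j) = Poly_Mapping.lookup m j"
    "g j + of_bool (j \<in> ?\<epsilon>) + nat (- ((int q *s v) $ j)) = Poly_Mapping.lookup m' j" for j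
    using pos[of j] by (auto simp: g_def v)
  then have "Poly_Mapping.single (expo g) 1 * (squarefree_monomial ?\<epsilon> * b) =
      Poly_Mapping.single m 1 - Poly_Mapping.single m' 1"
    by (simp only: b_def squarefree_monomial_times_binomial expo_lookup)
  ultimately show ?thesis
    unfolding L_def by (metis ideal_scale)
qed

section \<open>Decomposition of a polynomial vanishing everywhere\<close>

text \<open>Each class of monomials of \<open>F\<close> has a representative whose total coefficient
  over the class is zero, so subtracting the representatives changes nothing. Choosing them among
  the monomials of \<open>F\<close> itself lets them inherit the degree when \<open>F\<close> is
  homogeneous.\<close>

lemma vanishing_decomposition:
  fixes F :: "('r::finite, 'a::{field,finite}) mpoly"
  assumes "\<And>P. eval P F = 0"
  obtains rep where
    "\<And>m. m \<in> Poly_Mapping.keys F \<Longrightarrow> rep m \<in> Poly_Mapping.keys F"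
    "\<And>m j. m \<in> Poly_Mapping.keys F \<Longrightarrow> reduce_exp CARD('a) (Poly_Mapping.lookup m j) =
       reduce_exp CARD('a) (Poly_Mapping.lookup (rep m) j)"
    "F = (\<Sum>m\<in>Poly_Mapping.keys F. Poly_Mapping.single 0 (Poly_Mapping.lookup F m) *
       (Poly_Mapping.single m 1 - Poly_Mapping.single (rep m) 1))"
proof -
  define K where "K = Poly_Mapping.keys F"
  define R where "R = (\<lambda>m :: 'r \<Rightarrow>\<^sub>0 nat. \<lambda>j. reduce_exp CARD('a) (Poly_Mapping.lookup m j))"
  define T where "T = Pi\<^sub>E (UNIV :: 'r set) (\<lambda>_. {..<CARD('a)})"
  define rep where "rep = (\<lambda>f. SOME m. m \<in> K \<and> R m = f)"
  have [simp]: "finite K" "finite T" and RT: "R ` K \<subseteq> T"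
    by (auto simp: K_def T_def R_def card_field_ge_2 reduce_exp_less intro!: finite_PiE)
  have rep: "rep (R m) \<in> K \<and> R (rep (R m)) = R m" if "m \<in> K" for m
    unfolding rep_def using that by (intro someI_ex[of "\<lambda>m'. m' \<in> K \<and> R m' = R m"]) auto
  \<comment> \<open>Grouping the terms of \<open>F\<close> by reduced exponents turns its evaluation
    into a reduced function that vanishes identically; these class sums are its
    coefficients.\<close>
  have coeff: "(\<Sum>m | m \<in> K \<and> R m = f. Poly_Mapping.lookup F m) = 0" if "f \<in> T" for f
  proof (rule reduced_function_zero[of "UNIV :: 'r set"])
    fix P :: "'r \<Rightarrow> 'a"
    have "0 = eval (\<chi> j. P j) F"
      by (simp add: assms)
    also have "\<dots> = (\<Sum>m\<in>K. Poly_Mapping.lookup F m * (\<Prod>j\<in>UNIV. P j ^ R m j))"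
      by (simp add: eval_def K_def R_def power_reduce_exp)
    also have "\<dots> = (\<Sum>f\<in>T. \<Sum>m | m \<in> K \<and> R m = f. Poly_Mapping.lookup F m * (\<Prod>j\<in>UNIV. P j ^ R m j))"
      using RT by (intro sum.group[symmetric]) auto
    also have "\<dots> = (\<Sum>f\<in>T. (\<Sum>m | m \<in> K \<and> R m = f. Poly_Mapping.lookup F m) * (\<Prod>j\<in>UNIV. P j ^ f j))"
      by (simp add: sum_distrib_right)
    finally show "(\<Sum>f\<in>Pi\<^sub>E UNIV (\<lambda>_. {..<CARD('a)}). (\<Sum>m | m \<in> K \<and> R m = f. Poly_Mapping.lookup F m) *
        (\<Prod>j\<in>UNIV. P j ^ f j)) = 0"
      by (simp add: T_def)
  qed (use that in \<open>simp_all add: T_def\<close>)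
  \<comment> \<open>Grouped by class, the terms moved to the representatives carry exactly the class
    sums as coefficients, so their total is zero.\<close>
  have "(\<Sum>m\<in>K. Poly_Mapping.single (rep (R m)) (Poly_Mapping.lookup F m)) =
      (\<Sum>f\<in>T. \<Sum>m | m \<in> K \<and> R m = f. Poly_Mapping.single (rep (R m)) (Poly_Mapping.lookup F m))"
    using RT by (intro sum.group[symmetric]) auto
  also have "\<dots> = (\<Sum>f\<in>T. Poly_Mapping.single (rep f) (\<Sum>m | m \<in> K \<and> R m = f. Poly_Mapping.lookup F m))"
  proof (rule sum.cong[OF refl])
    fix f
    have "(\<Sum>m\<in>A. Poly_Mapping.single k (h m)) = Poly_Mapping.single k (sum h A)"
      for A :: "('r \<Rightarrow>\<^sub>0 nat) set" and k :: "'r \<Rightarrow>\<^sub>0 nat" and h :: "_ \<Rightarrow> 'a"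
      by (induction A rule: infinite_finite_induct) (simp_all add: single_add)
    then show "(\<Sum>m | m \<in> K \<and> R m = f. Poly_Mapping.single (rep (R m)) (Poly_Mapping.lookup F m)) =
        Poly_Mapping.single (rep f) (\<Sum>m | m \<in> K \<and> R m = f. Poly_Mapping.lookup F m)"
      by simp
  qed
  also have "\<dots> = 0"
    by (simp add: coeff)
  finally have zero: "(\<Sum>m\<in>K. Poly_Mapping.single (rep (R m)) (Poly_Mapping.lookup F m)) = 0" .
  show ?thesis
  proof (rule that[of "\<lambda>m. rep (R m)"])
    show "F = (\<Sum>m\<in>Poly_Mapping.keys F. Poly_Mapping.single 0 (Poly_Mapping.lookup F m) *
       (Poly_Mapping.single m 1 - Poly_Mapping.single (rep (R m)) 1))"
      using zero mpoly_sum_monomials[of F]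
      by (simp add: right_diff_distrib mult_single sum_subtractf K_def)
  qed (use rep in \<open>auto simp: K_def R_def fun_eq_iff\<close>)
qed

section \<open>The two inclusions between the ideals\<close>

theorem theorem3p7:
  fixes \<beta> :: "int ^ 'r ^ 'd" and \<phi> :: "int ^ 'n ^ 'r"
  assumes "\<And>i j. \<beta> $ i $ j \<ge> 0"
    and "rank (map_matrix real_of_int \<beta>) = CARD('d)"
    and "CARD('d) < CARD('r)"
    and "CARD('n) = CARD('r) - CARD('d)"
    and "inj ((*v) \<phi>)"
    and "range ((*v) \<phi>) = {m. \<beta> *v m = 0}"
    and "surj ((*v) \<beta>)"
    and "\<And>\<alpha>. finite_dimensional (graded_piece \<beta> \<alpha> :: ('r, 'a::{field,finite}) mpoly set)"
  shows "vanishing_ideal \<beta> \<phi> (affine_orbits \<phi> :: ('a ^ 'r) set set) =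
    (\<Sum>\<epsilon> | \<epsilon> \<noteq> {}. ideal ((\<lambda>F. squarefree_monomial \<epsilon> * F) `
        lattice_ideal \<epsilon> (scale_lattice (CARD('a) - 1) (kernel_lattice \<beta> \<epsilon>))))"
proof -
  define q where "q = CARD('a) - 1"
  have q: "q > 0"
    using card_field_ge_2[where 'a='a] by (simp add: q_def)
  define B where "B = (\<lambda>\<epsilon>. (\<lambda>F :: ('r, 'a) mpoly. squarefree_monomial \<epsilon> * F) `
    lattice_ideal \<epsilon> (scale_lattice q (kernel_lattice \<beta> \<epsilon>)))"
  define Z where "Z = {F :: ('r, 'a) mpoly. homogeneous \<beta> F \<and> (\<forall>P. eval P F = 0)}"
  \<comment> \<open>Every \<open>orbit \<phi> P\<close> lies in the range, so the orbit condition
    becomes vanishing at all points.\<close>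
  have "vanishing_ideal \<beta> \<phi> (affine_orbits \<phi> :: ('a ^ 'r) set set) = ideal Z"
    by (simp add: vanishing_ideal_def affine_orbits_def Z_def)
  moreover have "ideal Z = (\<Sum>\<epsilon> | \<epsilon> \<noteq> {}. ideal (B \<epsilon>))"
  proof (rule antisym)
    have "Z \<subseteq> (\<Sum>\<epsilon> | \<epsilon> \<noteq> {}. ideal (B \<epsilon>))"
    proof
      fix F assume "F \<in> Z"
      then obtain \<alpha> where F: "\<And>P. eval P F = 0"
        and deg: "\<And>m. m \<in> Poly_Mapping.keys F \<Longrightarrow> mono_degree \<beta> m = \<alpha>"
        by (auto simp: Z_def homogeneous_def graded_piece_def)
      obtain rep where
        rep: "\<And>m. m \<in> Poly_Mapping.keys F \<Longrightarrow> rep m \<in> Poly_Mapping.keys F"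
          "\<And>m j. m \<in> Poly_Mapping.keys F \<Longrightarrow> reduce_exp CARD('a) (Poly_Mapping.lookup m j) =
            reduce_exp CARD('a) (Poly_Mapping.lookup (rep m) j)"
        and F_eq: "F = (\<Sum>m\<in>Poly_Mapping.keys F. Poly_Mapping.single 0 (Poly_Mapping.lookup F m) *
            (Poly_Mapping.single m 1 - Poly_Mapping.single (rep m) 1))"
        by (rule vanishing_decomposition[OF F]) (rule that)
      have "Poly_Mapping.single m 1 - Poly_Mapping.single (rep m) 1 \<in> (\<Sum>\<epsilon> | \<epsilon> \<noteq> {}. ideal (B \<epsilon>))"
        if m: "m \<in> Poly_Mapping.keys F" for m
      proof (cases "Poly_Mapping.keys m = {}")
        \<comment> \<open>The constant monomial is alone in its class, since reduction preserves
          supports; its difference is zero, so the empty \<epsilon> contributes no term.\<close>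
        case True
        then have "m = rep m"
          using reduce_exp_eqD(1)[OF rep(2)[OF m]]
          by (intro poly_mapping_eqI) simp
        then show ?thesis
          by (simp add: subspace_zero subspace_sum_ideals)
      next
        case False
        \<comment> \<open>Here \<epsilon> is the common support of \<open>m\<close> and
          \<open>rep m\<close>; both monomials have degree \<alpha> because both occur in
          \<open>F\<close>.\<close>
        have "Poly_Mapping.single m 1 - Poly_Mapping.single (rep m) 1 \<in> ideal (B (Poly_Mapping.keys m))"
          unfolding B_def
          using q deg[OF m] deg[OF rep(1)[OF m]] reduce_exp_eqD[OF rep(2)[OF m]]
          by (intro monomial_diff_in_lattice_ideal) (auto simp: q_def)
        with False show ?thesis
          by (intro ideal_subset_sum_ideals) auto
      qed
      then show "F \<in> (\<Sum>\<epsilon> | \<epsilon> \<noteq> {}. ideal (B \<epsilon>))"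
        by (subst F_eq) (intro subspace_sum_closed subspace_mult subspace_sum_ideals; simp)
    qed
    then show "ideal Z \<subseteq> (\<Sum>\<epsilon> | \<epsilon> \<noteq> {}. ideal (B \<epsilon>))"
      by (intro ideal_minimal subspace_sum_ideals) simp_all
  next
    have "B \<epsilon> \<subseteq> ideal Z" for \<epsilon>
    proof
      fix G assume "G \<in> B \<epsilon>"
      then obtain T c where T: "T \<subseteq> lattice_binomial ` scale_lattice q (kernel_lattice \<beta> \<epsilon>)"
        and G: "G = squarefree_monomial \<epsilon> * (\<Sum>b\<in>T. c b * b)"
        by (auto simp: B_def lattice_ideal_def ideal_in_def)
      \<comment> \<open>The squarefree factor is distributed over the combination of binomials, so
        each generator need only be checked on a single binomial.\<close>
      have "squarefree_monomial \<epsilon> * b \<in> Z" if "b \<in> T" for b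
      proof -
        from that T obtain v where "v \<in> kernel_lattice \<beta> \<epsilon>" "b = lattice_binomial (int q *s v)"
          by (auto simp: scale_lattice_def)
        then show ?thesis
          unfolding Z_def q_def
          using squarefree_monomial_times_lattice_binomial_vanishes by blast
      qed
      then have "(\<Sum>b\<in>T. c b * (squarefree_monomial \<epsilon> * b)) \<in> ideal Z"
        by (intro ideal_sum ideal_scale ideal_base)
      also have "(\<Sum>b\<in>T. c b * (squarefree_monomial \<epsilon> * b)) = G"
        unfolding G sum_distrib_left by (intro sum.cong refl mult.left_commute)
      finally show "G \<in> ideal Z" .
    qed
    then have "ideal (B \<epsilon>) \<subseteq> ideal Z" for \<epsilon>
      by (intro ideal_minimal subspace_ideal)
    then show "(\<Sum>\<epsilon> | \<epsilon> \<noteq> {}. ideal (B \<epsilon>)) \<subseteq> ideal Z"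
      by (auto simp: set_sum_alt intro!: ideal_sum)
  qed
  ultimately show ?thesis
    by (simp add: B_def q_def)
qed

end
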